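(* Let the boundary profile $f_{LR}=f_L\mathbf 1_{p_1>0}+f_R\mathbf 1_{p_1<0}$ satisfy the boundary condition (B) of the context. Let $c_1>0$ and $M>0$ be constants and let $f\in L^\infty_{x_1}\big([0,1];L^1_p(\mathbb{R}^3,(p^0)^{1/2}dp)\big)$ satisfy $$\mathcal{L}f\ge c_1\qquad\text{and}\qquad \operatorname*{ess\,sup}_{x_1\in[0,1]}\int_{\mathbb{R}^3}|f(x_1,p)|(p^0)^{1/2}\,dp\le M .$$ Suppose furthermore that $$f(x_1,p)\ge \mathbf 1_{p_1>0}\,f_L(p)\exp\Big(-\frac{c_1x_1}{\hat p_1}\Big)+\mathbf 1_{p_1<0}\,f_R(p)\exp\Big(\frac{(1-x_1)c_1}{\hat p_1}\Big).$$ Then there exist positive constants $C_\ell$ and $C_u$, depending on $c_1$, $M$ and $f_{LR}$, such that $$C_\ell\,(p^0)^{1/2}\le(\mathcal{L}f)(x_1,p)\le C_u\,(p^0)^{1/2}.$$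
   Context: Notation. For $p=(p_1,p_2,p_3)\in\mathbb{R}^3$: $p^0=\sqrt{1+|p|^2}$, $\hat p_1=p_1/p^0$. For $p,q\in\mathbb{R}^3$: $g=g(p,q)=\sqrt{|p-q|^2-(p^0-q^0)^2}$, $s=g^2+4$, $v_{\o}=\dfrac{g\sqrt s}{p^0q^0}$. For $\omega\in\mathbb{S}^2$ and $\gamma=(p^0+q^0)/\sqrt s$, set $p'=\frac{p+q}2+\frac g2\big(\omega+(\gamma-1)(p+q)\frac{(p+q)\cdot\omega}{|p+q|^2}\big)$, $q'=p+q-p'$; the scattering angle $\theta$ is given by $\cos\theta=g^{-2}\big[-(p^0-q^0)(p'^0-q'^0)+(p-q)\cdot(p'-q')\big]$. Scattering kernel (hard spheres). $\sigma(g,\theta)\ge0$ is measurable with $\sigma(g,\theta)\approx g\,\sigma_0(\theta)$ (two-sided bounds with fixed positive constants), where $0\le\sigma_0(\theta)\le\frac1{4\pi}$ is measurable and $c_0=\int_{\mathbb{S}^2}\sigma_0(\theta)\,d\omega\in(0,1]$. Loss operator: $\mathcal{L}f(x_1,p)=\int_{\mathbb{R}^3}\int_{\mathbb{S}^2}v_{\o}\,\sigma(g,\theta)f(x_1,q)\,d\omega\,dq$. Pointwise statements in $x_1\in[0,1]$ for such Lebesgue classes are understood for almost every $x_1$. The constants $C_\ell,C_u$ may also depend on the fixed kernel $\sigma$. Boundary condition (B). Let $\varphi(p)=e^{kp^0}$ with a fixed $k>0$. For some $0<r_1<r_2<\infty$ put $Q_{r_1,r_2}=\{q: q_1\ge r_1,\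 r_1\le|q|\le r_2\}$ and $\bar Q_{r_1,r_2}=\{q: q_1\le -r_1,\ r_1\le|q|\le r_2\}$. Then $f_L\in L^1(Q_{r_1,r_2})$, $f_R\in L^1(\bar Q_{r_1,r_2})$, $f_{LR}\ge0$, $\int_{Q_{r_1,r_2}}f_L\,dq>0$, $\int_{\bar Q_{r_1,r_2}}f_R\,dq>0$, and $$\int_{\mathbb{R}^3}(p^0)^{1/2}\varphi(p)f_{LR}(p)\,dp\le M,\qquad \sup_{a\in\mathbb{R}^3}\int_{\mathbb{R}^3}\frac{(p^0)^{1/2}\varphi(p)}{|p-a|}f_{LR}(p)\,dp\le M$$ for a constant $M>0$. *)

theory Defs
  imports "HOL-Analysis.Analysis" "HOL-Probability.Essential_Supremum"
begin

definition energy :: "real^3 \<Rightarrow> real"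
  where "energy p = sqrt (1 + (norm p)\<^sup>2)"

definition phat1 :: "real^3 \<Rightarrow> real"
  where "phat1 p = p $ 1 / energy p"

definition rel_momentum :: "real^3 \<Rightarrow> real^3 \<Rightarrow> real"
  where "rel_momentum p q = sqrt ((norm (p - q))\<^sup>2 - (energy p - energy q)\<^sup>2)"

definition mandelstam_s :: "real^3 \<Rightarrow> real^3 \<Rightarrow> real"
  where "mandelstam_s p q = (rel_momentum p q)\<^sup>2 + 4"

definition moller_velocity :: "real^3 \<Rightarrow> real^3 \<Rightarrow> real"
  where "moller_velocity p q =
    rel_momentum p q * sqrt (mandelstam_s p q) / (energy p * energy q)"

definition lorentz_gamma :: "real^3 \<Rightarrow> real^3 \<Rightarrow> real"
  where "lorentz_gamma p q = (energy p + energy q) / sqrt (mandelstam_s p q)"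

(* For p + q = 0 the totalized division drops the second summand, which is the correct
   limit since then lorentz_gamma p q = 1. *)
definition post_p :: "real^3 \<Rightarrow> real^3 \<Rightarrow> real^3 \<Rightarrow> real^3"
  where "post_p p q \<omega> = (1/2) *\<^sub>R (p + q) + (rel_momentum p q / 2) *\<^sub>R
    (\<omega> + ((lorentz_gamma p q - 1) * (((p + q) \<bullet> \<omega>) / (norm (p + q))\<^sup>2)) *\<^sub>R (p + q))"

definition post_q :: "real^3 \<Rightarrow> real^3 \<Rightarrow> real^3 \<Rightarrow> real^3"
  where "post_q p q \<omega> = p + q - post_p p q \<omega>"

(* Meaningful for p \<noteq> q only; the diagonal is negligible for the integrals below. *)
definition scattering_angle :: "real^3 \<Rightarrow> real^3 \<Rightarrow> real^3 \<Rightarrow> real"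
  where "scattering_angle p q \<omega> = arccos
    ((- (energy p - energy q) * (energy (post_p p q \<omega>) - energy (post_q p q \<omega>))
      + (p - q) \<bullet> (post_p p q \<omega> - post_q p q \<omega>)) / (rel_momentum p q)\<^sup>2)"

(* The surface measure of the unit sphere S\<^sup>2, as the cone measure
   A \<mapsto> 3 * volume {t x | x \<in> A, 0 < t < 1}; its total mass is 4 pi, see below. *)
definition sphere_measure :: "(real^3) measure"
  where "sphere_measure = scale_measure 3
    (distr (restrict_space lborel (ball 0 1 - {0})) (restrict_space borel (sphere 0 1)) sgn)"

lemma space_sphere_measure [simp]: "space sphere_measure = sphere 0 1"
  by (simp add: sphere_measure_def space_scale_measure)

lemma emeasure_space_sphere_measure:
  "emeasure sphere_measure (space sphere_measure) = ennreal (4 * pi)"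
proof -
  let ?N = "restrict_space lborel (ball 0 1 - {0 :: real^3})"
  let ?S = "restrict_space borel (sphere 0 1 :: (real^3) set)"
  have sp: "space ?N = ball 0 1 - {0}"
    by (simp add: space_restrict_space)
  have m: "sgn \<in> ?N \<rightarrow>\<^sub>M ?S"
  proof (rule measurable_restrict_space2)
    show "sgn \<in> space ?N \<rightarrow> sphere 0 1"
      by (auto simp: sp norm_sgn)
    have "continuous_on (ball 0 1 - {0}) (sgn :: real^3 \<Rightarrow> _)"
      unfolding sgn_div_norm by (intro continuous_intros) auto
    then have "sgn \<in> borel_measurable (restrict_space borel (ball 0 1 - {0 :: real^3}))"
      by (rule borel_measurable_continuous_on_restrict)
    then show "sgn \<in> borel_measurable ?N"
      by (simp add: measurable_def sets_restrict_space space_restrict_space)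
  qed
  have "emeasure (distr ?N ?S sgn) (space ?S) = emeasure ?N (space ?N)"
    using emeasure_distr[OF m sets.top] measurable_space[OF m]
    by (metis Int_absorb1 subsetI vimageI)
  also have "\<dots> = emeasure lborel (ball 0 1 - {0 :: real^3})"
    unfolding sp by (rule emeasure_restrict_space) auto
  also have "\<dots> = emeasure lborel (ball 0 1 :: (real^3) set)"
    by (rule emeasure_Diff_null_set) auto
  also have "\<dots> = ennreal (4 / 3 * pi)"
    by (simp add: emeasure_ball unit_ball_vol_numeral fact_numeral)
  finally show ?thesis
    by (simp add: sphere_measure_def space_scale_measure flip: ennreal_numeral ennreal_mult)
qed

(* In the last conjunct \<theta> is the scattering angle of p, q; the integral does not depend on the
   choice of p \<noteq> q, and c0 is its value. *)
definition hard_sphere_kernel :: "(real \<Rightarrow> real \<Rightarrow> real) \<Rightarrow> (real \<Rightarrow> real) \<Rightarrow> bool"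
  where "hard_sphere_kernel \<sigma> \<sigma>0 \<longleftrightarrow>
    (\<lambda>(g, \<theta>). \<sigma> g \<theta>) \<in> borel_measurable (restrict_space borel ({0..} \<times> {0..pi})) \<and>
    (\<forall>g\<ge>0. \<forall>\<theta>\<in>{0..pi}. 0 \<le> \<sigma> g \<theta>) \<and>
    \<sigma>0 \<in> borel_measurable (restrict_space borel {0..pi}) \<and>
    (\<forall>\<theta>\<in>{0..pi}. 0 \<le> \<sigma>0 \<theta> \<and> \<sigma>0 \<theta> \<le> 1 / (4 * pi)) \<and>
    (\<exists>a>0. \<exists>b>0. \<forall>g\<ge>0. \<forall>\<theta>\<in>{0..pi}.
       a * (g * \<sigma>0 \<theta>) \<le> \<sigma> g \<theta> \<and> \<sigma> g \<theta> \<le> b * (g * \<sigma>0 \<theta>)) \<and>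
    (\<exists>c0\<in>{0<..1}. \<forall>p q. p \<noteq> q \<longrightarrow>
       (\<integral>\<omega>. \<sigma>0 (scattering_angle p q \<omega>) \<partial>sphere_measure) = c0)"

definition loss_operator ::
    "(real \<Rightarrow> real \<Rightarrow> real) \<Rightarrow> (real \<Rightarrow> real^3 \<Rightarrow> real) \<Rightarrow> real \<Rightarrow> real^3 \<Rightarrow> real"
  where "loss_operator \<sigma> f x p =
    (\<integral>q. (\<integral>\<omega>. moller_velocity p q * \<sigma> (rel_momentum p q) (scattering_angle p q \<omega>) * f x q
       \<partial>sphere_measure) \<partial>lebesgue)"

definition boundary_profile :: "(real^3 \<Rightarrow> real) \<Rightarrow> (real^3 \<Rightarrow> real) \<Rightarrow> real^3 \<Rightarrow> real"
  where "boundary_profile fL fR p =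
    fL p * indicator {p. p $ 1 > 0} p + fR p * indicator {p. p $ 1 < 0} p"

definition Q_right :: "real \<Rightarrow> real \<Rightarrow> (real^3) set"
  where "Q_right r1 r2 = {q. q $ 1 \<ge> r1 \<and> r1 \<le> norm q \<and> norm q \<le> r2}"

definition Q_left :: "real \<Rightarrow> real \<Rightarrow> (real^3) set"
  where "Q_left r1 r2 = {q. q $ 1 \<le> - r1 \<and> r1 \<le> norm q \<and> norm q \<le> r2}"

definition boundary_condition :: "real \<Rightarrow> (real^3 \<Rightarrow> real) \<Rightarrow> (real^3 \<Rightarrow> real) \<Rightarrow> bool"
  where "boundary_condition k fL fR \<longleftrightarrow>
    boundary_profile fL fR \<in> borel_measurable lebesgue \<and>
    (AE p in lebesgue. 0 \<le> boundary_profile fL fR p) \<and>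
    (\<exists>r1 r2. 0 < r1 \<and> r1 < r2 \<and>
       set_integrable lebesgue (Q_right r1 r2) fL \<and>
       set_integrable lebesgue (Q_left r1 r2) fR \<and>
       0 < (LINT q:Q_right r1 r2|lebesgue. fL q) \<and>
       0 < (LINT q:Q_left r1 r2|lebesgue. fR q)) \<and>
    (\<exists>M>0.
       (\<integral>\<^sup>+p. ennreal (sqrt (energy p) * exp (k * energy p) * boundary_profile fL fR p)
          \<partial>lebesgue) \<le> ennreal M \<and>
       (SUP a. \<integral>\<^sup>+p. ennreal (sqrt (energy p) * exp (k * energy p) / norm (p - a)
          * boundary_profile fL fR p) \<partial>lebesgue) \<le> ennreal M)"

definition mixed_norm :: "(real \<Rightarrow> real^3 \<Rightarrow> real) \<Rightarrow> ennreal"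
  where "mixed_norm f = esssup (lebesgue_on {0..1})
    (\<lambda>x. \<integral>\<^sup>+p. ennreal (\<bar>f x p\<bar> * sqrt (energy p)) \<partial>lebesgue)"

(* Representatives of elements of the Bochner space L^\<infinity>([0,1]; L^1(R^3, (p^0)^(1/2) dp)):
   strongly measurable maps into L^1 are the jointly Lebesgue measurable functions of (x, p). *)
definition mixed_space :: "(real \<Rightarrow> real^3 \<Rightarrow> real) set"
  where "mixed_space = {f. (\<lambda>(x, p). f x p) \<in> borel_measurable (lebesgue_on ({0..1} \<times> UNIV)) \<and>
    mixed_norm f < \<infinity>}"

end

theory Submission
  imports Defs
begin

text \<open>
  In the center-of-momentum frame \<open>\<theta>\<close> is the angle between \<open>\<omega>\<close> and a fixed vector of length \<open>g\<close>,
  so the angular integral of \<open>\<sigma>\<close> is comparable to \<open>g\<close>, and the loss operator integrates \<open>f\<close> against a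
  kernel comparable to \<open>v g = g\<^sup>2 sqrt s / (p\<^sup>0 q\<^sup>0)\<close>. Since \<open>g\<^sup>2, s \<le> 4 p\<^sup>0 q\<^sup>0\<close>, this is at most
  \<open>8 (p\<^sup>0 q\<^sup>0)\<^bsup>1/2\<^esup>\<close>, whence the upper bound. If \<open>q\<close> stays bounded and \<open>p\<close> is large, then
  \<open>g\<^sup>2 \<ge> c p\<^sup>0\<close> and \<open>v g \<ge> c' (p\<^sup>0)\<^bsup>1/2\<^esup>\<close>; the mass that \<open>f\<close> inherits from \<open>f\<^sub>L\<close> on \<open>Q\<^bsub>r1,r2\<^esub>\<close> then gives
  the lower bound. For bounded \<open>p\<close> the lower bound is the hypothesis \<open>\<L> f \<ge> c1\<close>.
\<close>

section \<open>Relativistic kinematics\<close>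

lemma energy_sq: "(energy p)\<^sup>2 = 1 + p \<bullet> p"
  by (simp add: energy_def power2_norm_eq_inner)

lemma energy_ge_1: "energy p \<ge> 1"
  by (simp add: energy_def)

lemma energy_pos [simp]: "energy p > 0"
  using energy_ge_1[of p] by linarith

lemma energy_nonneg [simp]: "energy p \<ge> 0"
  using energy_pos[of p] by linarith

lemma norm_less_energy: "norm p < energy p"
  by (simp add: energy_def real_less_rsqrt)

text \<open>Cauchy-Schwarz for the vectors (1, |p|) and (1, |q|): the squares differ by (|p| -
  |q|)^2. This is what makes the radicand of g nonnegative.\<close>

lemma energy_mult_ge: "1 + norm p * norm q \<le> energy p * energy q"
proof (rule power2_le_imp_le)
  have "(energy p * energy q)\<^sup>2 - (1 + norm p * norm q)\<^sup>2 = (norm p - norm q)\<^sup>2"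
    unfolding power_mult_distrib energy_sq
    by (simp add: power2_norm_eq_inner[symmetric] algebra_simps power2_eq_square)
  then show "(1 + norm p * norm q)\<^sup>2 \<le> (energy p * energy q)\<^sup>2"
    using zero_le_power2[of "norm p - norm q"] by linarith
qed simp

lemma rel_momentum_sq_raw:
  "(norm (p - q))\<^sup>2 - (energy p - energy q)\<^sup>2 = 2 * (energy p * energy q - p \<bullet> q - 1)"
  using energy_sq[of p] energy_sq[of q]
  by (simp add: power2_norm_eq_inner power2_diff inner_diff inner_commute)

lemma rel_momentum_sq: "(rel_momentum p q)\<^sup>2 = 2 * (energy p * energy q - p \<bullet> q - 1)"
  and rel_momentum_nonneg [simp]: "0 \<le> rel_momentum p q"
proof -
  have "p \<bullet> q + 1 \<le> energy p * energy q"
    using norm_cauchy_schwarz energy_mult_ge[of p q] by (smt (verit))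
  then have "0 \<le> 2 * (energy p * energy q - p \<bullet> q - 1)" by simp
  then show "(rel_momentum p q)\<^sup>2 = 2 * (energy p * energy q - p \<bullet> q - 1)" "0 \<le> rel_momentum p q"
    by (simp_all add: rel_momentum_def rel_momentum_sq_raw)
qed

lemma rel_momentum_refl [simp]: "rel_momentum p p = 0"
  by (simp add: rel_momentum_def)

text \<open>The invariant s is the Minkowski square of the total four-momentum.\<close>

lemma mandelstam_s_eq: "mandelstam_s p q = (energy p + energy q)\<^sup>2 - (p + q) \<bullet> (p + q)"
  using energy_sq[of p] energy_sq[of q]
  by (simp add: mandelstam_s_def rel_momentum_sq power2_sum inner_add inner_commute)

lemma mandelstam_s_pos [simp]: "mandelstam_s p q > 0"
  by (simp add: mandelstam_s_def add_nonneg_pos)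

lemma moller_velocity_nonneg [simp]: "0 \<le> moller_velocity p q"
  by (simp add: moller_velocity_def less_imp_le)

section \<open>Momenta and energies after the collision\<close>

lemma inner_add_self:
  assumes "S = sqrt (mandelstam_s p q)" and "E = energy p + energy q"
  shows "(p + q) \<bullet> (p + q) = (E - S) * (E + S)" "S > 0" "E > 0"
proof -
  have "S\<^sup>2 = E\<^sup>2 - (p + q) \<bullet> (p + q)"
    using less_imp_le[OF mandelstam_s_pos[of p q]] mandelstam_s_eq[of p q] by (simp add: assms)
  then show "(p + q) \<bullet> (p + q) = (E - S) * (E + S)"
    by (simp add: power2_eq_square algebra_simps)
  show "S > 0" "E > 0" by (simp_all add: assms add_pos_pos)
qed

text \<open>Since \<open>|p + q|\<^sup>2 = (E - S) (E + S)\<close>, the singularity at \<open>p + q = 0\<close> is removable.\<close>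

lemma post_p_eq:
  assumes S: "S = sqrt (mandelstam_s p q)" and E: "E = energy p + energy q"
  shows "post_p p q \<omega> = (1/2) *\<^sub>R (p + q) + (rel_momentum p q / 2) *\<^sub>R
    (\<omega> + (((p + q) \<bullet> \<omega>) / (S * (E + S))) *\<^sub>R (p + q))"
proof (cases "p + q = 0")
  case True
  then show ?thesis by (simp add: post_p_def)
next
  case False
  note N = inner_add_self[OF S E]
  have "(E - S) * (E + S) \<noteq> 0" using False unfolding N(1)[symmetric] by simp
  then have "(E / S - 1) * (w / ((E - S) * (E + S))) = w / (S * (E + S))" for w
    using N(2) by (simp add: divide_simps)
  then have "(lorentz_gamma p q - 1) * (((p + q) \<bullet> \<omega>) / (norm (p + q))\<^sup>2)
      = ((p + q) \<bullet> \<omega>) / (S * (E + S))"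
    unfolding lorentz_gamma_def power2_norm_eq_inner S[symmetric] E[symmetric] N(1) .
  then show ?thesis by (simp add: post_p_def)
qed

text \<open>The deviation of \<open>post_p\<close> from (p + q)/2 is linear in \<omega>, so
  subtracting it amounts to reversing \<omega>. Facts on p' thereby transfer to q'.\<close>

lemma post_q_eq: "post_q p q \<omega> = post_p p q (- \<omega>)"
proof -
  have "p + q = (1/2) *\<^sub>R (p + q) + (1/2) *\<^sub>R (p + q)"
    by (simp flip: scaleR_add_left)
  then show ?thesis
    unfolding post_q_def post_p_def
    by (simp add: inner_minus_right scaleR_diff_right scaleR_add_right scaleR_minus_right
        del: scaleR_half_double inner_add_left)
qed

lemma energy_post_p:
  assumes S: "S = sqrt (mandelstam_s p q)" and E: "E = energy p + energy q"
    and "norm \<omega> = 1"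
  shows "energy (post_p p q \<omega>) = E / 2 + rel_momentum p q / 2 * (((p + q) \<bullet> \<omega>) / S)"
proof -
  define P where "P = p + q"
  define w where "w = P \<bullet> \<omega>"
  define g where "g = rel_momentum p q"
  \<comment> \<open>The pair (\<open>w / S\<close>, \<open>u\<close>) is the Lorentz boost of (0,
    \<omega>) out of the center-of-momentum frame; hence
    \<open>u \<bullet> u - (w / S)\<^sup>2 = 1\<close>.\<close>
  define u where "u = \<omega> + (w / (S * (E + S))) *\<^sub>R P"
  have N: "P \<bullet> P = (E - S) * (E + S)" "S > 0" "E > 0"
    using inner_add_self[OF S E] by (simp_all add: P_def)
  have Ssq: "S\<^sup>2 = g\<^sup>2 + 4"
    using less_imp_le[OF mandelstam_s_pos[of p q]] by (simp add: S g_def mandelstam_s_def)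
  have \<omega>: "\<omega> \<bullet> \<omega> = 1" using assms(3) by (simp add: dot_square_norm)
  have nz: "E + S \<noteq> 0" "S \<noteq> 0" using N by auto
  have Pu: "P \<bullet> u = w * E / S"
    unfolding u_def inner_add_right inner_scaleR_right N(1) w_def[symmetric]
    using nz by (simp add: divide_simps) (simp add: algebra_simps)
  have "u \<bullet> u = 1 + 2 * w * (w / (S * (E + S))) + (w / (S * (E + S)))\<^sup>2 * (P \<bullet> P)"
    by (simp add: u_def inner_add \<omega> w_def inner_commute power2_eq_square)
  also have "\<dots> = 1 + (w / S)\<^sup>2"
    unfolding N using nz by (simp add: divide_simps power2_eq_square) (simp add: algebra_simps)
  finally have uu: "u \<bullet> u = 1 + (w / S)\<^sup>2" .
  have post: "post_p p q \<omega> = (1/2) *\<^sub>R P + (g / 2) *\<^sub>R u"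
    unfolding post_p_eq[OF S E] by (simp add: P_def g_def u_def w_def)
  have "1 + post_p p q \<omega> \<bullet> post_p p q \<omega>
      = 1 + (P \<bullet> P) / 4 + g / 2 * (P \<bullet> u) + g\<^sup>2 / 4 * (u \<bullet> u)"
    unfolding post by (simp add: inner_add inner_commute power2_eq_square)
  \<comment> \<open>Writing the summand 1 as (S^2 - g^2)/4 completes the square.\<close>
  also have "\<dots> = (S\<^sup>2 - g\<^sup>2) / 4 + (E\<^sup>2 - S\<^sup>2) / 4 + g / 2 * (w * E / S) + g\<^sup>2 / 4 * (1 + (w / S)\<^sup>2)"
  proof -
    have PP: "P \<bullet> P = E\<^sup>2 - S\<^sup>2" unfolding N by (simp add: power2_eq_square algebra_simps)
    have one: "(S\<^sup>2 - g\<^sup>2) / 4 = 1" using Ssq by simp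
    show ?thesis unfolding PP Pu uu one ..
  qed
  also have "\<dots> = (E / 2 + g / 2 * (w / S))\<^sup>2"
    using nz by (simp add: power2_eq_square field_simps)
  finally have sq: "1 + post_p p q \<omega> \<bullet> post_p p q \<omega> = (E / 2 + g / 2 * (w / S))\<^sup>2" .
  \<comment> \<open>The square root returns this expression and not its negative, because |w| \<le>
    |P| \<le> E and g \<le> S.\<close>
  have "0 \<le> E / 2 + g / 2 * (w / S)"
  proof -
    have "norm P \<le> E"
      using norm_triangle_ineq[of p q] norm_less_energy[of p] norm_less_energy[of q]
      unfolding P_def E by linarith
    then have "\<bar>w\<bar> \<le> E"
      using Cauchy_Schwarz_ineq2[of P \<omega>] assms(3) unfolding w_def by simp
    moreover have "g \<le> S"
      by (rule power2_le_imp_le) (use Ssq N in auto)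
    moreover have "0 \<le> g" by (simp add: g_def)
    ultimately have "g * \<bar>w\<bar> \<le> S * E" using N by (intro mult_mono) auto
    moreover have "- (g * \<bar>w\<bar>) \<le> g * w"
      using \<open>0 \<le> g\<close> by (simp add: abs_if)
    ultimately have "0 \<le> (S * E + g * w) / (2 * S)" using N by simp
    also have "\<dots> = E / 2 + g / 2 * (w / S)" using nz by (simp add: field_simps)
    finally show ?thesis .
  qed
  then show ?thesis
    by (simp add: energy_def power2_norm_eq_inner sq g_def w_def P_def)
qed

section \<open>The scattering angle in the center-of-momentum frame\<close>

text \<open>The spatial part of $p-q$ in the center-of-momentum frame.\<close>

definition cm_direction :: "real^3 \<Rightarrow> real^3 \<Rightarrow> real^3"
  where "cm_direction p q = (p - q) -
    ((energy p - energy q) / (energy p + energy q + sqrt (mandelstam_s p q))) *\<^sub>R (p + q)"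

text \<open>Difference of the two mass-shell relations: as four-vectors, p - q and p + q are
  Minkowski-orthogonal.\<close>

lemma inner_diff_add_energy:
  "(p - q) \<bullet> (p + q) = (energy p - energy q) * (energy p + energy q)"
  using energy_sq[of p] energy_sq[of q]
  by (simp add: inner_add inner_diff inner_commute power2_eq_square algebra_simps)

text \<open>By this orthogonality p - q has no time component in the center-of-momentum frame, so
  its spatial part has the invariant length g.\<close>

lemma norm_cm_direction: "norm (cm_direction p q) = rel_momentum p q"
proof -
  define S E d where "S = sqrt (mandelstam_s p q)" and "E = energy p + energy q"
    and "d = energy p - energy q"
  note N = inner_add_self[OF S_def E_def]
  have nz: "E + S \<noteq> 0" using N by auto
  have "(norm (cm_direction p q))\<^sup>2 = (p - q) \<bullet> (p - q)
      - 2 * (d / (E + S)) * ((p - q) \<bullet> (p + q)) + (d / (E + S))\<^sup>2 * ((p + q) \<bullet> (p + q))"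
    unfolding power2_norm_eq_inner cm_direction_def S_def[symmetric] E_def[symmetric] d_def[symmetric]
    unfolding inner_diff_left[of "p - q"] inner_diff_right[of _ "p - q"]
    by (simp add: inner_commute power2_eq_square del: inner_add_left inner_add_right)
  also have "\<dots> = (p - q) \<bullet> (p - q) - d\<^sup>2"
    unfolding inner_diff_add_energy N(1) E_def[symmetric] d_def[symmetric]
    using nz by (simp add: divide_simps power2_eq_square) (simp add: algebra_simps)
  finally show ?thesis
    unfolding rel_momentum_def d_def power2_norm_eq_inner[symmetric]
    by (metis norm_ge_zero real_sqrt_unique)
qed

text \<open>The numerator of cos \<theta> is the Minkowski product of p - q and p' - q', which
  equals g times \<open>cm_direction p q \<bullet> \<omega>\<close>. For g = 0 both quotients are 0
  by totalized division.\<close>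

lemma scattering_angle_eq:
  assumes "norm \<omega> = 1"
  shows "scattering_angle p q \<omega> = arccos (cm_direction p q \<bullet> \<omega> / rel_momentum p q)"
proof -
  define S E d where "S = sqrt (mandelstam_s p q)" and "E = energy p + energy q"
    and "d = energy p - energy q"
  define g where "g = rel_momentum p q"
  define w where "w = (p + q) \<bullet> \<omega>"
  note N = inner_add_self[OF S_def E_def]
  have nz: "E + S \<noteq> 0" "S \<noteq> 0" using N by auto
  have e: "energy (post_p p q \<omega>) - energy (post_q p q \<omega>) = g * w / S"
    unfolding post_q_eq using assms
    by (simp add: energy_post_p[OF S_def E_def] g_def w_def inner_minus_right)
  define u where "u = \<omega> + (w / (S * (E + S))) *\<^sub>R (p + q)"
  have "post_p p q \<omega> = (1/2) *\<^sub>R (p + q) + (g / 2) *\<^sub>R u"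
    unfolding post_p_eq[OF S_def E_def] g_def u_def w_def ..
  moreover have "- u = - \<omega> + ((p + q) \<bullet> (- \<omega>) / (S * (E + S))) *\<^sub>R (p + q)"
    by (simp add: u_def w_def del: inner_add_left)
  then have "post_q p q \<omega> = (1/2) *\<^sub>R (p + q) + (g / 2) *\<^sub>R (- u)"
    unfolding post_q_eq post_p_eq[OF S_def E_def] g_def by simp
  ultimately have "post_p p q \<omega> - post_q p q \<omega> = g *\<^sub>R u"
    by (simp flip: scaleR_add_left)
  then have m: "(p - q) \<bullet> (post_p p q \<omega> - post_q p q \<omega>)
      = g * ((p - q) \<bullet> \<omega> + w / (S * (E + S)) * (d * E))"
    by (simp add: u_def inner_add_right[of "p - q" \<omega>] inner_diff_add_energy d_def E_def
        del: inner_add_left inner_diff_left)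
  have cm: "cm_direction p q \<bullet> \<omega> = (p - q) \<bullet> \<omega> - d / (E + S) * w"
    unfolding cm_direction_def inner_diff_left[of "p - q"]
    by (simp add: S_def E_def d_def w_def)
  have "- d * (g * w / S) + g * ((p - q) \<bullet> \<omega> + w / (S * (E + S)) * (d * E))
      = g * (cm_direction p q \<bullet> \<omega>)"
    unfolding cm using nz by (simp add: divide_simps) (simp add: algebra_simps)
  then show ?thesis
    unfolding scattering_angle_def e m
    by (simp add: d_def g_def[symmetric] power2_eq_square)
qed

text \<open>Cauchy-Schwarz, since \<open>cm_direction p q\<close> has length g; for g = 0 the
  quotient is 0. The argument of arccos thus stays in its domain.\<close>

lemma cos_scattering_angle_bounds:
  assumes "norm \<omega> = 1"
  shows "- 1 \<le> cm_direction p q \<bullet> \<omega> / rel_momentum p q"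
    and "cm_direction p q \<bullet> \<omega> / rel_momentum p q \<le> 1"
proof -
  have "\<bar>cm_direction p q \<bullet> \<omega>\<bar> \<le> rel_momentum p q"
    using Cauchy_Schwarz_ineq2[of "cm_direction p q" \<omega>] assms by (simp add: norm_cm_direction)
  then show "- 1 \<le> cm_direction p q \<bullet> \<omega> / rel_momentum p q"
    "cm_direction p q \<bullet> \<omega> / rel_momentum p q \<le> 1"
    by (auto simp: abs_le_iff le_divide_eq divide_le_eq)
qed

lemma scattering_angle_range:
  assumes "norm \<omega> = 1"
  shows "scattering_angle p q \<omega> \<in> {0..pi}"
  using cos_scattering_angle_bounds[OF assms, of p q]
  by (auto simp: scattering_angle_eq[OF assms] intro!: arccos_lbound arccos_ubound)

text \<open>Supplies measurability of the angle on the sphere. If g = 0, the closed form is the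
  constant arccos 0.\<close>

lemma continuous_on_scattering_angle: "continuous_on (sphere 0 1) (scattering_angle p q)"
proof (subst continuous_on_cong[OF refl])
  show "continuous_on (sphere 0 1) (\<lambda>\<omega>. arccos (cm_direction p q \<bullet> \<omega> / rel_momentum p q))"
  proof (cases "rel_momentum p q = 0")
    case False
    then show ?thesis
      using cos_scattering_angle_bounds[of _ p q]
      by (intro continuous_intros) auto
  qed simp
qed (simp add: scattering_angle_eq)

section \<open>Two-sided bounds on the product v g\<close>

lemma moller_velocity_rel_momentum_le:
  "moller_velocity p q * rel_momentum p q \<le> 8 * sqrt (energy p) * sqrt (energy q)"
proof -
  define e where "e = energy p * energy q"
  have e: "e > 0" by (simp add: e_def)
  \<comment> \<open>This yields g^2 \<le> 4 e - 4, and the 4 that s adds to g^2 just fits.\<close>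
  have "- (p \<bullet> q) \<le> e - 1"
    using energy_mult_ge[of p q] Cauchy_Schwarz_ineq2[of p q] unfolding e_def by linarith
  then have g: "(rel_momentum p q)\<^sup>2 \<le> 4 * e" and s: "mandelstam_s p q \<le> 4 * e"
    by (simp_all add: mandelstam_s_def rel_momentum_sq flip: e_def)
  have "sqrt (mandelstam_s p q) \<le> 2 * sqrt e"
    using real_sqrt_le_mono[OF s] by (simp add: real_sqrt_mult)
  then have "(rel_momentum p q)\<^sup>2 * sqrt (mandelstam_s p q) \<le> (4 * e) * (2 * sqrt e)"
    using g e by (intro mult_mono) (auto intro: less_imp_le)
  then have "(rel_momentum p q)\<^sup>2 * sqrt (mandelstam_s p q) / e \<le> 8 * sqrt e"
    using e by (simp add: divide_le_eq mult_ac)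
  then show ?thesis
    by (simp add: moller_velocity_def e_def real_sqrt_mult power2_eq_square mult_ac)
qed

lemma moller_velocity_rel_momentum_ge:
  assumes q: "energy q \<le> R" and p: "4 * R \<le> energy p"
  shows "sqrt (energy p) / (8 * R ^ 3) \<le> moller_velocity p q * rel_momentum p q"
proof -
  have R: "R \<ge> 1" using q energy_ge_1[of q] by linarith
  \<comment> \<open>The gap between q0 and |q| is the reciprocal of q0 + |q|, hence bounded below
    while q0 \<le> R.\<close>
  have "1 = (energy q + norm q) * (energy q - norm q)"
    using energy_sq[of q] by (simp add: dot_square_norm power2_eq_square algebra_simps)
  also have "\<dots> \<le> (2 * R) * (energy q - norm q)"
    using norm_less_energy[of q] q by (intro mult_right_mono) auto
  finally have gap: "1 / (2 * R) \<le> energy q - norm q"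
    using R by (simp add: divide_le_eq mult_ac)
  have "p \<bullet> q \<le> energy p * norm q"
    using norm_cauchy_schwarz[of p q]
      mult_right_mono[OF less_imp_le[OF norm_less_energy[of p]], of "norm q"]
    by simp
  moreover have "energy p * (1 / (2 * R)) \<le> energy p * (energy q - norm q)"
    using gap by (intro mult_left_mono) auto
  \<comment> \<open>The threshold 4 R serves this: with t = p0/(2 R) one has g^2 \<ge> 2 (t - 1),
    and t \<ge> 2 turns this into g^2 \<ge> t.\<close>
  moreover have "2 \<le> energy p / (2 * R)"
    using p R by (simp add: le_divide_eq)
  ultimately have g: "energy p / (2 * R) \<le> (rel_momentum p q)\<^sup>2"
    unfolding rel_momentum_sq by (simp add: right_diff_distrib field_simps)
  then have s: "energy p / (2 * R) \<le> mandelstam_s p q"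
    by (simp add: mandelstam_s_def)
  have "sqrt (energy p) / (2 * R) \<le> sqrt (energy p / (2 * R))"
  proof -
    have "sqrt (2 * R) \<le> 2 * R" using R by (intro real_le_lsqrt) (auto simp: power2_eq_square)
    then show ?thesis using R by (simp add: real_sqrt_divide frac_le)
  qed
  also have "\<dots> \<le> sqrt (mandelstam_s p q)" using s by simp
  finally have "energy p / (2 * R) * (sqrt (energy p) / (2 * R))
      \<le> (rel_momentum p q)\<^sup>2 * sqrt (mandelstam_s p q)"
    using g R by (intro mult_mono) auto
  then have "energy p / (2 * R) * (sqrt (energy p) / (2 * R)) / (energy p * R)
      \<le> (rel_momentum p q)\<^sup>2 * sqrt (mandelstam_s p q) / (energy p * energy q)"
    using q R less_imp_le[OF mandelstam_s_pos[of p q]]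
    by (intro frac_le mult_nonneg_nonneg mult_left_mono) auto
  \<comment> \<open>The right side equals sqrt p0 / (4 R^3), so the 8 leaves slack.\<close>
  moreover have "sqrt (energy p) / (8 * R ^ 3)
      \<le> energy p / (2 * R) * (sqrt (energy p) / (2 * R)) / (energy p * R)"
    using R by (simp add: field_simps power3_eq_cube)
  ultimately show ?thesis
    by (simp add: moller_velocity_def power2_eq_square mult_ac)
qed

section \<open>The collision frequency\<close>

lemma sets_sphere_measure [measurable_cong]:
  "sets sphere_measure = sets (restrict_space borel (sphere 0 1))"
  by (simp add: sphere_measure_def)

text \<open>The pointwise bounds by multiples of g \<sigma>0 are integrated over the sphere, where
  \<sigma>0 has integral c0; the constants are \<open>a * c0\<close> and
  \<open>b * c0\<close>.\<close>

lemma kernel_integral_bounds: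
  assumes "hard_sphere_kernel \<sigma> \<sigma>0"
  obtains A B where "A > 0" "B > 0"
    "\<And>p q. A * rel_momentum p q \<le>
      (\<integral>\<omega>. \<sigma> (rel_momentum p q) (scattering_angle p q \<omega>) \<partial>sphere_measure)"
    "\<And>p q. (\<integral>\<omega>. \<sigma> (rel_momentum p q) (scattering_angle p q \<omega>) \<partial>sphere_measure)
      \<le> B * rel_momentum p q"
proof -
  note kernel = assms[unfolded hard_sphere_kernel_def]
  have meas: "(\<lambda>(g, \<theta>). \<sigma> g \<theta>) \<in> borel_measurable (restrict_space borel ({0..} \<times> {0..pi}))"
    using kernel by (rule conjunct1)
  have nonneg: "0 \<le> \<sigma> g \<theta>" if "g \<ge> 0" "\<theta> \<in> {0..pi}" for g \<theta>
    using kernel[THEN conjunct2, THEN conjunct1] that by simp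
  obtain a b where ab: "a > 0" "b > 0"
    and "\<forall>g\<ge>0. \<forall>\<theta>\<in>{0..pi}. a * (g * \<sigma>0 \<theta>) \<le> \<sigma> g \<theta> \<and> \<sigma> g \<theta> \<le> b * (g * \<sigma>0 \<theta>)"
    using kernel by (elim conjE exE) (rule that)
  then have bounds: "a * (g * \<sigma>0 \<theta>) \<le> \<sigma> g \<theta> \<and> \<sigma> g \<theta> \<le> b * (g * \<sigma>0 \<theta>)"
    if "g \<ge> 0" "\<theta> \<in> {0..pi}" for g \<theta>
    using that by simp
  obtain c0 where "c0 \<in> {0<..1}"
    and "\<forall>p q. p \<noteq> q \<longrightarrow> (\<integral>\<omega>. \<sigma>0 (scattering_angle p q \<omega>) \<partial>sphere_measure) = c0"
    using kernel by (elim conjE bexE) (rule that)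
  then have c0: "c0 > 0"
    and c0_eq: "\<And>p q. p \<noteq> q \<Longrightarrow> (\<integral>\<omega>. \<sigma>0 (scattering_angle p q \<omega>) \<partial>sphere_measure) = c0"
    by simp_all
  have *: "a * c0 * rel_momentum p q \<le>
        (\<integral>\<omega>. \<sigma> (rel_momentum p q) (scattering_angle p q \<omega>) \<partial>sphere_measure) \<and>
      (\<integral>\<omega>. \<sigma> (rel_momentum p q) (scattering_angle p q \<omega>) \<partial>sphere_measure)
        \<le> b * c0 * rel_momentum p q" (is "?low \<and> ?up") for p q
  proof (cases "p = q")
    case True
    \<comment> \<open>The value c0 is given off the diagonal only; on it g = 0, and the bounds
      squeeze \<sigma> to 0.\<close>
    have "(\<integral>\<omega>. \<sigma> 0 (scattering_angle q q \<omega>) \<partial>sphere_measure) = (\<integral>\<omega>. 0 \<partial>sphere_measure)"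
      using bounds[of 0] by (intro Bochner_Integration.integral_cong refl)
        (force dest: scattering_angle_range[of _ q q])
    then show ?thesis by (simp add: True)
  next
    case False
    let ?g = "rel_momentum p q" and ?\<theta> = "scattering_angle p q"
    note range = scattering_angle_range[of _ p q]
    \<comment> \<open>A nonintegrable function has Bochner integral 0, so the value c0 > 0 forces
      integrability.\<close>
    have int0: "integrable sphere_measure (\<lambda>\<omega>. \<sigma>0 (?\<theta> \<omega>))"
      using c0_eq[OF False] c0 not_integrable_integral_eq by fastforce
    \<comment> \<open>Measurability of \<sigma> is given on the restricted domain, so the inner map
      has to be measurable into that space.\<close>
    have "(\<lambda>\<omega>. (?g, ?\<theta> \<omega>)) \<in> sphere_measure \<rightarrow>\<^sub>M restrict_space borel ({0..} \<times> {0..pi})"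
    proof (rule measurable_restrict_space2)
      show "(\<lambda>\<omega>. (?g, ?\<theta> \<omega>)) \<in> space sphere_measure \<rightarrow> {0..} \<times> {0..pi}"
        using range by auto
      have "continuous_on (sphere 0 1) (\<lambda>\<omega>. (?g, ?\<theta> \<omega>))"
        by (intro continuous_intros continuous_on_scattering_angle)
      then show "(\<lambda>\<omega>. (?g, ?\<theta> \<omega>)) \<in> borel_measurable sphere_measure"
        using borel_measurable_continuous_on_restrict measurable_cong_sets[OF sets_sphere_measure refl]
        by blast
    qed
    from measurable_compose[OF this meas]
    have m: "(\<lambda>\<omega>. \<sigma> ?g (?\<theta> \<omega>)) \<in> borel_measurable sphere_measure" by simp
    have int: "integrable sphere_measure (\<lambda>\<omega>. \<sigma> ?g (?\<theta> \<omega>))"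
    proof (rule Bochner_Integration.integrable_bound[OF _ m])
      show "integrable sphere_measure (\<lambda>\<omega>. b * (?g * \<sigma>0 (?\<theta> \<omega>)))"
        using int0 by simp
      show "AE \<omega> in sphere_measure. norm (\<sigma> ?g (?\<theta> \<omega>)) \<le> norm (b * (?g * \<sigma>0 (?\<theta> \<omega>)))"
      proof (rule AE_I2)
        fix \<omega> assume "\<omega> \<in> space sphere_measure"
        then have "?\<theta> \<omega> \<in> {0..pi}" using range by simp
        then show "norm (\<sigma> ?g (?\<theta> \<omega>)) \<le> norm (b * (?g * \<sigma>0 (?\<theta> \<omega>)))"
          using bounds[of ?g "?\<theta> \<omega>"] nonneg[of ?g "?\<theta> \<omega>"] by simp
      qed
    qed
    have "(\<integral>\<omega>. a * (?g * \<sigma>0 (?\<theta> \<omega>)) \<partial>sphere_measure) \<le> (\<integral>\<omega>. \<sigma> ?g (?\<theta> \<omega>) \<partial>sphere_measure)"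
      using int0 int bounds range by (intro integral_mono) auto
    moreover have "(\<integral>\<omega>. \<sigma> ?g (?\<theta> \<omega>) \<partial>sphere_measure) \<le> (\<integral>\<omega>. b * (?g * \<sigma>0 (?\<theta> \<omega>)) \<partial>sphere_measure)"
      using int0 int bounds range by (intro integral_mono) auto
    ultimately show ?thesis by (simp add: c0_eq[OF False] mult_ac)
  qed
  show ?thesis
    by (rule that[of "a * c0" "b * c0"]) (use * ab c0 in auto)
qed

text \<open>The integral kernel of the loss operator: f does not depend on \<omega> and leaves the
  angular integral.\<close>

definition collision_frequency ::
    "(real \<Rightarrow> real \<Rightarrow> real) \<Rightarrow> real^3 \<Rightarrow> real^3 \<Rightarrow> real"
  where "collision_frequency \<sigma> p q = moller_velocity p q *
    (\<integral>\<omega>. \<sigma> (rel_momentum p q) (scattering_angle p q \<omega>) \<partial>sphere_measure)"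

lemma loss_operator_eq:
  "loss_operator \<sigma> f x p = (\<integral>q. collision_frequency \<sigma> p q * f x q \<partial>lebesgue)"
  by (simp add: loss_operator_def collision_frequency_def)

lemma collision_frequency_bounds:
  assumes "hard_sphere_kernel \<sigma> \<sigma>0"
  obtains A B where "A > 0" "B > 0"
    "\<And>p q. 0 \<le> collision_frequency \<sigma> p q"
    "\<And>p q. collision_frequency \<sigma> p q \<le> B * (sqrt (energy p) * sqrt (energy q))"
    "\<And>p q R. energy q \<le> R \<Longrightarrow> 4 * R \<le> energy p \<Longrightarrow>
      A / R ^ 3 * sqrt (energy p) \<le> collision_frequency \<sigma> p q"
proof -
  obtain A B where AB: "A > 0" "B > 0"
    and low: "\<And>p q. A * rel_momentum p q \<le>
      (\<integral>\<omega>. \<sigma> (rel_momentum p q) (scattering_angle p q \<omega>) \<partial>sphere_measure)"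
    and up: "\<And>p q. (\<integral>\<omega>. \<sigma> (rel_momentum p q) (scattering_angle p q \<omega>) \<partial>sphere_measure)
      \<le> B * rel_momentum p q"
    using kernel_integral_bounds[OF assms] by metis
  have l: "A * (moller_velocity p q * rel_momentum p q) \<le> collision_frequency \<sigma> p q" for p q
    using mult_left_mono[OF low[of p q] moller_velocity_nonneg[of p q]]
    by (simp add: collision_frequency_def mult_ac)
  have u: "collision_frequency \<sigma> p q \<le> B * (moller_velocity p q * rel_momentum p q)" for p q
    using mult_left_mono[OF up[of p q] moller_velocity_nonneg[of p q]]
    by (simp add: collision_frequency_def mult_ac)
  show ?thesis
  \<comment> \<open>The factors 1/8 and 8 come from the lower and upper bounds on v g.\<close>
  proof (rule that[of "A / 8" "8 * B"])
    fix p q R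
    show "0 \<le> collision_frequency \<sigma> p q"
      using AB by (intro order_trans[OF _ l] mult_nonneg_nonneg) auto
    show "collision_frequency \<sigma> p q \<le> 8 * B * (sqrt (energy p) * sqrt (energy q))"
      using order_trans[OF u mult_left_mono[OF moller_velocity_rel_momentum_le]] AB
      by (simp add: mult_ac)
    show "A / 8 / R ^ 3 * sqrt (energy p) \<le> collision_frequency \<sigma> p q"
      if "energy q \<le> R" "4 * R \<le> energy p"
      using order_trans[OF mult_left_mono[OF moller_velocity_rel_momentum_ge[OF that]] l] AB
      by simp
  qed (use AB in auto)
qed

section \<open>Bounds on the loss operator\<close>

lemma loss_operator_le:
  assumes K: "\<And>q. 0 \<le> collision_frequency \<sigma> p q"
      "\<And>q. collision_frequency \<sigma> p q \<le> B * (sqrt (energy p) * sqrt (energy q))"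
    and "B > 0" "M \<ge> 0"
    and M: "(\<integral>\<^sup>+q. ennreal (\<bar>f x q\<bar> * sqrt (energy q)) \<partial>lebesgue) \<le> ennreal M"
  shows "loss_operator \<sigma> f x p \<le> B * M * sqrt (energy p)"
proof -
  define C where "C = B * sqrt (energy p)"
  have C: "C > 0" using \<open>B > 0\<close> by (simp add: C_def)
  have "collision_frequency \<sigma> p q * f x q / C \<le> \<bar>f x q\<bar> * sqrt (energy q)" for q
  proof -
    have "collision_frequency \<sigma> p q * f x q \<le> collision_frequency \<sigma> p q * \<bar>f x q\<bar>"
      using K by (intro mult_left_mono) auto
    also have "\<dots> \<le> B * (sqrt (energy p) * sqrt (energy q)) * \<bar>f x q\<bar>"
      using K by (intro mult_right_mono) auto
    finally show ?thesis
      using C by (simp add: C_def pos_divide_le_eq mult_ac)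
  qed
  then have "(\<integral>\<^sup>+q. ennreal (collision_frequency \<sigma> p q * f x q / C) \<partial>lebesgue)
      \<le> (\<integral>\<^sup>+q. ennreal (\<bar>f x q\<bar> * sqrt (energy q)) \<partial>lebesgue)"
    by (intro nn_integral_mono ennreal_leI)
  \<comment> \<open>If the integrand is not integrable, its integral is 0, which
    \<open>M \<ge> 0\<close> covers.\<close>
  then have "(\<integral>q. collision_frequency \<sigma> p q * f x q / C \<partial>lebesgue) \<le> M"
    using M \<open>M \<ge> 0\<close> by (intro integral_real_bounded) auto
  then show ?thesis
    using C by (simp add: loss_operator_eq C_def pos_divide_le_eq mult_ac)
qed

text \<open>On \<open>Q_right r1 r2\<close> the quotient q0/q1 is at most sqrt(1 + r2^2)/r1, so the
  damping of the incoming data is uniformly bounded below.\<close>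

lemma exp_phat1_ge:
  assumes "q \<in> Q_right r1 r2" "0 < r1" "0 \<le> x" "x \<le> 1" "c \<ge> 0"
  shows "exp (- (c * sqrt (1 + r2\<^sup>2) / r1)) \<le> exp (- (c * x / phat1 q))"
    and "energy q \<le> sqrt (1 + r2\<^sup>2)"
proof -
  have q: "r1 \<le> q $ 1" "norm q \<le> r2" using assms by (auto simp: Q_right_def)
  then have "(norm q)\<^sup>2 \<le> r2\<^sup>2" by (intro power_mono) auto
  then show E: "energy q \<le> sqrt (1 + r2\<^sup>2)" by (simp add: energy_def)
  have "x * energy q \<le> 1 * sqrt (1 + r2\<^sup>2)"
    using assms E by (intro mult_mono) auto
  then have "c * (x * energy q) / q $ 1 \<le> c * sqrt (1 + r2\<^sup>2) / r1"
    using assms q by (intro frac_le mult_left_mono) auto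
  then show "exp (- (c * sqrt (1 + r2\<^sup>2) / r1)) \<le> exp (- (c * x / phat1 q))"
    by (simp add: phat1_def mult_ac)
qed

text \<open>The integral is cut down to S, where the integrand is at least D \<epsilon> h; off S it
  is nonnegative.\<close>

lemma loss_operator_ge:
  assumes K: "\<And>q. 0 \<le> collision_frequency \<sigma> p q"
      "\<And>q. q \<in> S \<Longrightarrow> D \<le> collision_frequency \<sigma> p q" and "D \<ge> 0" "\<epsilon> \<ge> 0"
    and f: "AE q in lebesgue. 0 \<le> f x q"
      "AE q in lebesgue. q \<in> S \<longrightarrow> \<epsilon> * h q \<le> f x q"
    and h: "set_integrable lebesgue S h"
    and pos: "loss_operator \<sigma> f x p \<noteq> 0"
  shows "D * \<epsilon> * (LINT q:S|lebesgue. h q) \<le> loss_operator \<sigma> f x p"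
proof -
  \<comment> \<open>A Bochner integral with nonzero value has an integrable integrand, so no joint
    measurability of the collision frequency has to be established.\<close>
  have int: "integrable lebesgue (\<lambda>q. collision_frequency \<sigma> p q * f x q)"
    using pos not_integrable_integral_eq unfolding loss_operator_eq by blast
  have "(\<integral>q. D * \<epsilon> * (indicator S q *\<^sub>R h q) \<partial>lebesgue)
      \<le> (\<integral>q. collision_frequency \<sigma> p q * f x q \<partial>lebesgue)"
  proof (rule integral_mono_AE)
    show "integrable lebesgue (\<lambda>q. D * \<epsilon> * (indicator S q *\<^sub>R h q))"
      using h unfolding set_integrable_def by (rule integrable_mult_right)
    show "AE q in lebesgue. D * \<epsilon> * (indicator S q *\<^sub>R h q) \<le> collision_frequency \<sigma> p q * f x q"
      using f
    proof eventually_elim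
      case (elim q)
      show ?case
      proof (cases "q \<in> S")
        case True
        have "D * (\<epsilon> * h q) \<le> D * f x q"
          using elim True \<open>D \<ge> 0\<close> by (intro mult_left_mono) auto
        also have "\<dots> \<le> collision_frequency \<sigma> p q * f x q"
          using elim K True by (intro mult_right_mono) auto
        finally show ?thesis using True by simp
      next
        case False
        then show ?thesis using K elim by simp
      qed
    qed
  qed (rule int)
  then show ?thesis
    by (simp add: set_lebesgue_integral_def loss_operator_eq)
qed

theorem proposition2p1:
  fixes \<sigma> :: "real \<Rightarrow> real \<Rightarrow> real" and \<sigma>0 :: "real \<Rightarrow> real"
    and fL fR :: "real^3 \<Rightarrow> real" and k c1 M :: real
  assumes "hard_sphere_kernel \<sigma> \<sigma>0"
    and "k > 0"
    and "boundary_condition k fL fR"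
    and "c1 > 0"
    and "M > 0"
  shows "\<exists>Cl>0. \<exists>Cu>0. \<forall>f\<in>mixed_space.
    (AE x in lebesgue_on {0..1}. \<forall>p. loss_operator \<sigma> f x p \<ge> c1) \<longrightarrow>
    mixed_norm f \<le> ennreal M \<longrightarrow>
    (AE x in lebesgue_on {0..1}. AE p in lebesgue.
       f x p \<ge> indicator {p. p $ 1 > 0} p * fL p * exp (- (c1 * x / phat1 p))
             + indicator {p. p $ 1 < 0} p * fR p * exp ((1 - x) * c1 / phat1 p)) \<longrightarrow>
    (AE x in lebesgue_on {0..1}. \<forall>p.
       Cl * sqrt (energy p) \<le> loss_operator \<sigma> f x p \<and>
       loss_operator \<sigma> f x p \<le> Cu * sqrt (energy p))"
proof -
  obtain A B where A: "A > 0" and B: "B > 0"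
    and K0: "\<And>p q. 0 \<le> collision_frequency \<sigma> p q"
    and Ku: "\<And>p q. collision_frequency \<sigma> p q \<le> B * (sqrt (energy p) * sqrt (energy q))"
    and Kl: "\<And>p q R. energy q \<le> R \<Longrightarrow> 4 * R \<le> energy p \<Longrightarrow>
      A / R ^ 3 * sqrt (energy p) \<le> collision_frequency \<sigma> p q"
    using collision_frequency_bounds[OF assms(1)] by metis
  have fLR: "AE p in lebesgue. 0 \<le> boundary_profile fL fR p"
    using assms(3) by (simp add: boundary_condition_def)
  obtain r1 r2 where r1: "0 < r1"
    and fL: "set_integrable lebesgue (Q_right r1 r2) fL"
      "0 < (LINT q:Q_right r1 r2|lebesgue. fL q)"
    using assms(3) unfolding boundary_condition_def by blast
  \<comment> \<open>R bounds the energy on \<open>Q_right r1 r2\<close>, \<epsilon> bounds the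
    damping factor there from below, and J is the incoming mass.\<close>
  define R where "R = sqrt (1 + r2\<^sup>2)"
  define \<epsilon> where "\<epsilon> = exp (- (c1 * R / r1))"
  define J where "J = (LINT q:Q_right r1 r2|lebesgue. fL q)"
  \<comment> \<open>The first entry serves p0 < 4 R, the second p0 \<ge> 4 R.\<close>
  define Cl where "Cl = min (c1 / sqrt (4 * R)) (A / R ^ 3 * \<epsilon> * J)"
  have R: "R > 0" and J: "J > 0" using fL by (simp_all add: R_def J_def add_pos_nonneg)
  show ?thesis
  proof (intro exI conjI ballI impI)
    show "Cl > 0" using R J A \<open>c1 > 0\<close> by (simp add: Cl_def \<epsilon>_def)
    show "B * M > 0" using B \<open>M > 0\<close> by simp
    fix f
    assume c1: "AE x in lebesgue_on {0..1}. \<forall>p. loss_operator \<sigma> f x p \<ge> c1"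
      and M: "mixed_norm f \<le> ennreal M"
      and lower: "AE x in lebesgue_on {0..1}. AE p in lebesgue.
       f x p \<ge> indicator {p. p $ 1 > 0} p * fL p * exp (- (c1 * x / phat1 p))
             + indicator {p. p $ 1 < 0} p * fR p * exp ((1 - x) * c1 / phat1 p)"
    have "AE x in lebesgue_on {0..1}.
        (\<integral>\<^sup>+p. ennreal (\<bar>f x p\<bar> * sqrt (energy p)) \<partial>lebesgue) \<le> mixed_norm f"
      unfolding mixed_norm_def by (rule esssup_AE)
    moreover have "AE x in lebesgue_on {0..1}. x \<in> {0..1::real}"
      by (rule AE_I2) simp
    ultimately show "AE x in lebesgue_on {0..1}. \<forall>p.
       Cl * sqrt (energy p) \<le> loss_operator \<sigma> f x p \<and>
       loss_operator \<sigma> f x p \<le> B * M * sqrt (energy p)"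
      using c1 lower
    proof eventually_elim
      case (elim x)
      have x: "0 \<le> x" "x \<le> 1" using elim(2) by auto
      \<comment> \<open>The assumed lower bound is the nonnegative boundary profile times
        exponentials; where p1 = 0 both indicators vanish and it reads 0 \<le> f.\<close>
      have f0: "AE q in lebesgue. 0 \<le> f x q"
        using elim(4) fLR
      proof eventually_elim
        case (elim q)
        then show ?case
          by (cases "q $ 1" "0 :: real" rule: linorder_cases)
            (auto simp: boundary_profile_def intro: order_trans[rotated])
      qed
      have f1: "AE q in lebesgue. q \<in> Q_right r1 r2 \<longrightarrow> \<epsilon> * fL q \<le> f x q"
        using elim(4) fLR
      proof eventually_elim
        case (elim q)
        show ?case
        proof
          assume Q: "q \<in> Q_right r1 r2"
          then have "q $ 1 > 0" using r1 by (auto simp: Q_right_def)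
          \<comment> \<open>The sign of \<open>fL\<close> is read off from the profile; it allows
            the exponential to be replaced by the smaller \<epsilon>.\<close>
          then have "0 \<le> fL q" "fL q * exp (- (c1 * x / phat1 q)) \<le> f x q"
            using elim by (simp_all add: boundary_profile_def)
          moreover have "\<epsilon> \<le> exp (- (c1 * x / phat1 q))"
            unfolding \<epsilon>_def R_def using exp_phat1_ge(1)[OF Q r1 x] \<open>c1 > 0\<close> by simp
          ultimately show "\<epsilon> * fL q \<le> f x q"
            by (metis mult.commute mult_left_mono order_trans)
        qed
      qed
      show ?case
      proof (intro allI conjI)
        fix p
        have c1_le: "c1 \<le> loss_operator \<sigma> f x p" using elim(3) by simp
        show "loss_operator \<sigma> f x p \<le> B * M * sqrt (energy p)"
          using K0 Ku B \<open>M > 0\<close> order_trans[OF elim(1) M] by (intro loss_operator_le) auto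
        show "Cl * sqrt (energy p) \<le> loss_operator \<sigma> f x p"
        proof (cases "4 * R \<le> energy p")
          case True
          \<comment> \<open>Here D is \<open>A / R ^ 3 * sqrt (energy p)\<close>, which carries the
            growth in p; the loss term is nonzero because it is at least c1 > 0.\<close>
          have "A / R ^ 3 * sqrt (energy p) * \<epsilon> * J \<le> loss_operator \<sigma> f x p"
            unfolding J_def
          proof (rule loss_operator_ge[where \<epsilon> = \<epsilon> and x = x and f = f and h = fL,
                OF K0 _ _ _ f0 f1 fL(1)])
            show "A / R ^ 3 * sqrt (energy p) \<le> collision_frequency \<sigma> p q"
              if "q \<in> Q_right r1 r2" for q
              using Kl[OF exp_phat1_ge(2)[OF that r1 x], of 0 p] True by (simp add: R_def)
          qed (use A R c1_le \<open>c1 > 0\<close> in \<open>auto simp: \<epsilon>_def\<close>)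
          moreover have "Cl * sqrt (energy p) \<le> A / R ^ 3 * \<epsilon> * J * sqrt (energy p)"
            by (intro mult_right_mono) (auto simp: Cl_def)
          ultimately show ?thesis by (simp add: mult_ac)
        next
          case False
          \<comment> \<open>The right side is c1, which the hypothesis on the loss operator puts
            below it.\<close>
          have "Cl * sqrt (energy p) \<le> c1 / sqrt (4 * R) * sqrt (4 * R)"
            using False R \<open>c1 > 0\<close> by (intro mult_mono) (auto simp: Cl_def)
          then show ?thesis using c1_le R by simp
        qed
      qed
    qed
  qed
qed

end
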